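(* Let $L\ge 1$ be an integer, let $0<r,\ell<\infty$, and consider the two-component exclusion process on $\Lambda=\{-L+1,\dots,L\}$ with asymmetry parameter $q=\sqrt{r/\ell}$. For configurations $\mathbf{z},\boldsymbol{\eta}\in\mathbb{S}^{2L}$ put $$D(\mathbf{z},\boldsymbol{\eta})=\pi^{-1}(\mathbf{z})\,Q_{\mathbf{z}}(\boldsymbol{\eta}),$$ where $\pi^{-1}(\mathbf{z})=1/\pi(\mathbf{z})$ and $\pi$ is the reversible measure $$\pi(\boldsymbol{\eta}) = q^{\,\sum_{k=-L+1}^{L}(2k-1)(a_k-b_k)+\sum_{k=-L+1}^{L-1}\sum_{l=-L+1}^{k}\left(a_l b_{k+1}-b_l a_{k+1}\right)} .$$ Then the process is self-dual with respect to the (family of) duality functions $D$; that is, for all $\mathbf{z},\boldsymbol{\eta}\in\mathbb{S}^{2L}$ and all $t\ge 0$, $$\mathbb{E}\left[D(\mathbf{z},\boldsymbol{\eta}_t)\,\middle|\,\boldsymbol{\eta}_0=\boldsymbol{\eta}\right]=\mathbb{E}\left[D(\mathbf{z}_t,\boldsymbol{\eta})\,\middle|\,\mathbf{z}_0=\mathbf{z}\right],$$ where $(\boldsymbol{\eta}_t)$ and $(\mathbf{z}_t)$ are both two-component exclusion processes with the same rates $r,\ell$.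
   Context: Configurations: $\mathbb{S}=\{0,1,2\}$; a configuration is $\boldsymbol{\eta}=\{\eta(-L+1),\dots,\eta(L)\}\in\mathbb{S}^{2L}$, where $\eta(k)=0$ means that site $k\in\Lambda$ is occupied by a particle of type $A$, $\eta(k)=1$ that it is vacant, and $\eta(k)=2$ that it is occupied by a particle of type $B$. Local occupation variables: $a_k=\delta_{\eta(k),0}$, $v_k=\delta_{\eta(k),1}$, $b_k=\delta_{\eta(k),2}$ (the argument $\boldsymbol{\eta}$ is suppressed). Equivalently a configuration is given by its particle positions $\mathbf{z}=\{\mathbf{x},\mathbf{y}\}$, where $\mathbf{x}=\{x_1,\dots,x_{N(\mathbf{z})}\}\subseteq\Lambda$ is the set of sites occupied by $A$-particles and $\mathbf{y}=\{y_1,\dots,y_{M(\mathbf{z})}\}\subseteq\Lambda$ the (disjoint) set of sites occupied by $B$-particles; $N(\mathbf{z})=|\mathbf{x}|$, $M(\mathbf{z})=|\mathbf{y}|$. $\pi(\mathbf{z})$ means $\pi$ evaluated at the configuration with these positions. Process (two-component ASEP): for $-L+1\le k\le L-1$, $\boldsymbol{\eta}^{kk+1}$ is the configuration obtained from $\boldsymbol{\eta}$ by interchanging $\eta(k)$ and $\eta(k+1)$. The process is the continuous-time Markov chain on $\mathbb{S}^{2L}$ with generator $$\mathcal{L}f(\boldsymbol{\eta})=\sum_{k=-L+1}^{L-1}w^{kk+1}(\boldsymbol{\eta})\,[f(\boldsymbol{\eta}^{kk+1})-f(\boldsymbol{\eta})],$$ $$w^{kk+1}(\boldsymbol{\eta})=r\,(a_kv_{k+1}+v_kb_{k+1}+a_kb_{k+1})+\ell\,(v_ka_{k+1}+b_kv_{k+1}+b_ka_{k+1}).$$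 Functions: for $x,y\in\Lambda$ and $\boldsymbol{\eta}\in\mathbb{S}^{2L}$, $$Q_x^A(\boldsymbol{\eta})=q^{\sum_{k=-L+1}^{x-1}a_k-\sum_{k=x+1}^{L}a_k}\,a_x,\qquad Q_y^B(\boldsymbol{\eta})=q^{-\sum_{k=-L+1}^{y-1}b_k+\sum_{k=y+1}^{L}b_k}\,b_y,$$ and for $\mathbf{z}=\{\mathbf{x},\mathbf{y}\}$ (a configuration unrelated to $\boldsymbol{\eta}$) $$Q_{\mathbf{z}}(\boldsymbol{\eta})=\prod_{i=1}^{N(\mathbf{z})}Q^A_{x_i}(\boldsymbol{\eta})\prod_{i=1}^{M(\mathbf{z})}Q^B_{y_i}(\boldsymbol{\eta})$$ (empty sums are $0$, empty products are $1$). *)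

theory Defs
  imports "HOL-Probability.Probability"
begin

section \<open>Continuous-time Markov chains on a finite state space\<close>

text \<open>
  \<open>P t x y\<close> is the probability of going from \<open>x\<close> to \<open>y\<close> in time \<open>t\<close>. The last conjunct says that
  the generator \<open>\<L> f = lim (P\<^sub>t f - f) / t\<close> (as \<open>t\<close> decreases to 0) is \<open>G\<close>; only the values of
  \<open>P\<close> at times \<open>t \<ge> 0\<close> and at states in \<open>S\<close> matter.
\<close>

definition transition_function ::
    "'s set \<Rightarrow> (('s \<Rightarrow> real) \<Rightarrow> 's \<Rightarrow> real) \<Rightarrow> (real \<Rightarrow> 's \<Rightarrow> 's \<Rightarrow> real) \<Rightarrow> bool" where
  "transition_function S G P \<longleftrightarrow>
     (\<forall>t\<ge>0. \<forall>x\<in>S. \<forall>y\<in>S. 0 \<le> P t x y) \<and>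
     (\<forall>t\<ge>0. \<forall>x\<in>S. (\<Sum>y\<in>S. P t x y) = 1) \<and>
     (\<forall>x\<in>S. \<forall>y\<in>S. P 0 x y = of_bool (x = y)) \<and>
     (\<forall>s\<ge>0. \<forall>t\<ge>0. \<forall>x\<in>S. \<forall>y\<in>S. P (s + t) x y = (\<Sum>u\<in>S. P s x u * P t u y)) \<and>
     (\<forall>f. \<forall>x\<in>S. ((\<lambda>t. ((\<Sum>y\<in>S. P t x y * f y) - f x) / t) \<longlongrightarrow> G f x) (at_right 0))"

text \<open>
  A process \<open>X\<close> on the probability space \<open>M\<close> is a time-homogeneous Markov chain with state space
  \<open>S\<close> and generator \<open>G\<close>. The initial distribution is arbitrary, and no path regularity is
  required. In the Markov property, \<open>J\<close> is a finite set of past times and \<open>xs\<close> an observed past.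
\<close>

definition markov_chain ::
    "'s set \<Rightarrow> (('s \<Rightarrow> real) \<Rightarrow> 's \<Rightarrow> real) \<Rightarrow> 'w measure \<Rightarrow> (real \<Rightarrow> 'w \<Rightarrow> 's) \<Rightarrow> bool" where
  "markov_chain S G M X \<longleftrightarrow>
     prob_space M \<and> finite S \<and>
     (\<forall>t\<ge>0. X t \<in> measurable M (count_space S)) \<and>
     (\<exists>P. transition_function S G P \<and>
       (\<forall>s\<ge>0. \<forall>h\<ge>0. \<forall>x\<in>S. \<forall>y\<in>S. \<forall>J xs. finite J \<longrightarrow> J \<subseteq> {0..s} \<longrightarrow>
          \<P>(w in M. X s w = x \<and> (\<forall>u\<in>J. X u w = xs u)) > 0 \<longrightarrow>
          \<P>(w in M. X (s + h) w = y \<bar> X s w = x \<and> (\<forall>u\<in>J. X u w = xs u)) = P h x y))"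

text \<open>
  Elementary conditional expectation of \<open>f\<close> given an event of positive probability, the analogue
  for expectations of \<^const>\<open>cond_prob\<close>.
\<close>

definition cond_expect :: "'w measure \<Rightarrow> ('w \<Rightarrow> real) \<Rightarrow> ('w \<Rightarrow> bool) \<Rightarrow> real" where
  "cond_expect M f Q = (LINT w:{w \<in> space M. Q w}|M. f w) / \<P>(w in M. Q w)"


section \<open>The two-component asymmetric exclusion process\<close>

text \<open>
  Configurations are functions on the integers with values in \<open>{0, 1, 2}\<close> on the lattice
  (0: particle of type A, 1: vacant, 2: particle of type B) and \<^const>\<open>undefined\<close> off it.
\<close>

type_synonym config = "int \<Rightarrow> nat"

definition sites :: "int \<Rightarrow> int set" where
  "sites L = {-L + 1..L}"

definition configs :: "int \<Rightarrow> config set" where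
  "configs L = sites L \<rightarrow>\<^sub>E {0, 1, 2}"

definition occ_a :: "config \<Rightarrow> int \<Rightarrow> int" where
  "occ_a \<eta> k = of_bool (\<eta> k = 0)"

definition occ_v :: "config \<Rightarrow> int \<Rightarrow> int" where
  "occ_v \<eta> k = of_bool (\<eta> k = 1)"

definition occ_b :: "config \<Rightarrow> int \<Rightarrow> int" where
  "occ_b \<eta> k = of_bool (\<eta> k = 2)"

definition swap_config :: "config \<Rightarrow> int \<Rightarrow> config" where
  "swap_config \<eta> k = \<eta>(k := \<eta> (k + 1), k + 1 := \<eta> k)"

definition rate :: "real \<Rightarrow> real \<Rightarrow> int \<Rightarrow> config \<Rightarrow> real" where
  "rate r l k \<eta> =
     r * real_of_int (occ_a \<eta> k * occ_v \<eta> (k+1) + occ_v \<eta> k * occ_b \<eta> (k+1) + occ_a \<eta> k * occ_b \<eta> (k+1)) +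
     l * real_of_int (occ_v \<eta> k * occ_a \<eta> (k+1) + occ_b \<eta> k * occ_v \<eta> (k+1) + occ_b \<eta> k * occ_a \<eta> (k+1))"

definition asep2_generator :: "real \<Rightarrow> real \<Rightarrow> int \<Rightarrow> (config \<Rightarrow> real) \<Rightarrow> config \<Rightarrow> real" where
  "asep2_generator r l L f \<eta> =
     (\<Sum>k\<in>{-L + 1..L - 1}. rate r l k \<eta> * (f (swap_config \<eta> k) - f \<eta>))"

definition asep2 :: "real \<Rightarrow> real \<Rightarrow> int \<Rightarrow> 'w measure \<Rightarrow> (real \<Rightarrow> 'w \<Rightarrow> config) \<Rightarrow> bool" where
  "asep2 r l L M X \<longleftrightarrow> markov_chain (configs L) (asep2_generator r l L) M X"

definition rev_measure :: "real \<Rightarrow> int \<Rightarrow> config \<Rightarrow> real" where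
  "rev_measure q L \<eta> =
     q powi ((\<Sum>k\<in>{-L + 1..L}. (2 * k - 1) * (occ_a \<eta> k - occ_b \<eta> k)) +
             (\<Sum>k\<in>{-L + 1..L - 1}. \<Sum>m\<in>{-L + 1..k}.
                occ_a \<eta> m * occ_b \<eta> (k + 1) - occ_b \<eta> m * occ_a \<eta> (k + 1)))"

definition QA :: "real \<Rightarrow> int \<Rightarrow> int \<Rightarrow> config \<Rightarrow> real" where
  "QA q L x \<eta> =
     q powi ((\<Sum>k\<in>{-L + 1..x - 1}. occ_a \<eta> k) - (\<Sum>k\<in>{x + 1..L}. occ_a \<eta> k)) * real_of_int (occ_a \<eta> x)"

definition QB :: "real \<Rightarrow> int \<Rightarrow> int \<Rightarrow> config \<Rightarrow> real" where
  "QB q L y \<eta> =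
     q powi (- (\<Sum>k\<in>{-L + 1..y - 1}. occ_b \<eta> k) + (\<Sum>k\<in>{y + 1..L}. occ_b \<eta> k)) * real_of_int (occ_b \<eta> y)"

definition a_positions :: "int \<Rightarrow> config \<Rightarrow> int set" where
  "a_positions L z = {x \<in> sites L. z x = 0}"

definition b_positions :: "int \<Rightarrow> config \<Rightarrow> int set" where
  "b_positions L z = {y \<in> sites L. z y = 2}"

definition Q_config :: "real \<Rightarrow> int \<Rightarrow> config \<Rightarrow> config \<Rightarrow> real" where
  "Q_config q L z \<eta> = (\<Prod>x\<in>a_positions L z. QA q L x \<eta>) * (\<Prod>y\<in>b_positions L z. QB q L y \<eta>)"

definition duality_fun :: "real \<Rightarrow> int \<Rightarrow> config \<Rightarrow> config \<Rightarrow> real" where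
  "duality_fun q L z \<eta> = inverse (rev_measure q L z) * Q_config q L z \<eta>"

end

theory Submission
  imports Defs
begin

text \<open>
  Duality of two Markov chains on finite state spaces is a statement about their generators. If
  applying one generator to the first argument of \<open>D\<close> gives the same as applying the other to the
  second argument, then \<open>\<phi> s = E D(z\<^sub>t\<^sub>-\<^sub>s, \<eta>\<^sub>s)\<close>, computed for independent copies, does not depend on
  \<open>s \<in> {0..t}\<close>, and its values at \<open>s = t\<close> and \<open>s = 0\<close> are the two sides of the duality relation
  (\<open>transition_function_duality\<close>, \<open>markov_chain_duality\<close>). Transition functions are given only by
  their right derivative at time 0, so instead of differentiating \<open>\<phi>\<close> one bounds its increments over
  a step of length \<open>h\<close> by a quantity \<open>\<epsilon> h = o(h)\<close> that does not depend on \<open>s\<close>, and adds up.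

  For the exclusion process the generator relation holds already for each bond \<open>(k, k + 1)\<close>
  (\<open>duality_fun_bond\<close>). Exchanging the two sites of a bond leaves unchanged the number of particles
  of each type to the left and to the right of the bond, and so every factor of \<open>Q\<close> at other sites.
  Hence \<open>Q\<close> is a common factor times a weight that depends only on the four occupation values at
  the bond and on two numbers \<open>\<alpha>\<close>, \<open>\<beta>\<close> (\<open>Q_config_bond\<close>). Detailed balance for \<open>\<pi>\<close>
  (\<open>detailed_balance\<close>) moves the exchange in \<open>z\<close> past the factor \<open>1 / \<pi>(z)\<close>, which turns the jumps
  out of \<open>z\<close> into jumps into \<open>z\<close>. What remains is an identity between polynomials in \<open>\<alpha>\<close>, \<open>\<beta>\<close>,
  \<open>q\<close>, \<open>1 / q\<close> for each of the \<open>3 ^ 4\<close> local configurations (\<open>bond_weight_duality\<close>).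
\<close>

section \<open>Duality of generators implies duality of semigroups\<close>

text \<open>
  The sum \<open>\<phi> s\<close> interpolates between the two sides. By the semigroup property, its increment from \<open>s\<close>
  to \<open>s + h\<close> is an average, with weights at most 1, of the differences \<open>e h y u\<close> between running the
  first chain from \<open>y\<close> and the second from \<open>u\<close> for time \<open>h\<close>. The hypothesis on the generators makes
  these differences \<open>o(h)\<close>, and there are finitely many of them.
\<close>

lemma transition_function_duality:
  fixes P :: "real \<Rightarrow> 's \<Rightarrow> 's \<Rightarrow> real" and R :: "real \<Rightarrow> 'u \<Rightarrow> 'u \<Rightarrow> real"
    and D :: "'u \<Rightarrow> 's \<Rightarrow> real"
  assumes P: "transition_function S G P" and R: "transition_function U H R"
    and S: "finite S" and U: "finite U"
    and dual: "\<And>x z. x \<in> S \<Longrightarrow> z \<in> U \<Longrightarrow> G (D z) x = H (\<lambda>u. D u x) z"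
    and x: "x \<in> S" and z: "z \<in> U" and t: "t \<ge> 0"
  shows "(\<Sum>y\<in>S. P t x y * D z y) = (\<Sum>u\<in>U. R t z u * D u x)"
proof -
  define e where "e h y u = (\<Sum>y'\<in>S. P h y y' * D u y') - (\<Sum>u'\<in>U. R h u u' * D u' y)" for h y u
  define \<epsilon> where "\<epsilon> h = (\<Sum>y\<in>S. \<Sum>u\<in>U. \<bar>e h y u\<bar>)" for h
  define \<phi> where "\<phi> s = (\<Sum>y\<in>S. \<Sum>u\<in>U. P s x y * R (t - s) z u * D u y)" for s
  have P_nonneg: "0 \<le> P s x y" if "s \<ge> 0" "x \<in> S" "y \<in> S" for s x y
    using P that by (auto simp: transition_function_def)
  have R_nonneg: "0 \<le> R s x y" if "s \<ge> 0" "x \<in> U" "y \<in> U" for s x y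
    using R that by (auto simp: transition_function_def)
  have P_sum: "(\<Sum>y\<in>S. P s x y) = 1" if "s \<ge> 0" "x \<in> S" for s x
    using P that by (auto simp: transition_function_def)
  have R_sum: "(\<Sum>y\<in>U. R s x y) = 1" if "s \<ge> 0" "x \<in> U" for s x
    using R that by (auto simp: transition_function_def)
  have P_0: "P 0 x y = of_bool (x = y)" if "x \<in> S" "y \<in> S" for x y
    using P that by (auto simp: transition_function_def)
  have R_0: "R 0 x y = of_bool (x = y)" if "x \<in> U" "y \<in> U" for x y
    using R that by (auto simp: transition_function_def)
  have P_add: "P (s + h) x y = (\<Sum>u\<in>S. P s x u * P h u y)"
    if "s \<ge> 0" "h \<ge> 0" "x \<in> S" "y \<in> S" for s h x y
    using P that unfolding transition_function_def by blast
  have R_add: "R (s + h) x y = (\<Sum>u\<in>U. R s x u * R h u y)"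
    if "s \<ge> 0" "h \<ge> 0" "x \<in> U" "y \<in> U" for s h x y
    using R that unfolding transition_function_def by blast
  have P_gen: "((\<lambda>t. ((\<Sum>y\<in>S. P t x y * f y) - f x) / t) \<longlongrightarrow> G f x) (at_right 0)"
    if "x \<in> S" for f x
    using P that by (auto simp: transition_function_def)
  have R_gen: "((\<lambda>t. ((\<Sum>y\<in>U. R t x y * f y) - f x) / t) \<longlongrightarrow> H f x) (at_right 0)"
    if "x \<in> U" for f x
    using R that by (auto simp: transition_function_def)

  have e_lim: "((\<lambda>h. e h y u / h) \<longlongrightarrow> 0) (at_right 0)" if "y \<in> S" "u \<in> U" for y u
    using tendsto_diff[OF P_gen[OF that(1), of "D u"] R_gen[OF that(2), of "\<lambda>v. D v y"]]
    by (simp add: e_def dual[OF that] diff_divide_distrib[symmetric])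
  have \<epsilon>_lim: "((\<lambda>h. \<epsilon> h / h) \<longlongrightarrow> 0) (at_right 0)"
  proof -
    have "((\<lambda>h. \<Sum>y\<in>S. \<Sum>u\<in>U. \<bar>e h y u / h\<bar>) \<longlongrightarrow> 0) (at_right 0)"
      by (intro tendsto_null_sum tendsto_rabs_zero e_lim)
    moreover have "\<forall>\<^sub>F h in at_right (0::real). (\<Sum>y\<in>S. \<Sum>u\<in>U. \<bar>e h y u / h\<bar>) = \<epsilon> h / h"
      using eventually_at_right_less[of "0::real"]
      by eventually_elim (simp add: \<epsilon>_def sum_divide_distrib)
    ultimately show ?thesis
      by (rule Lim_transform_eventually)
  qed

  (* In \<phi> (s + h) the first chain, and in \<phi> s the second chain, makes an additional step of length h
     at the end, starting from the same pair of states (y, u). *)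
  have step: "\<bar>\<phi> (s + h) - \<phi> s\<bar> \<le> \<epsilon> h" if s: "s \<ge> 0" and h: "h \<ge> 0" and sh: "s + h \<le> t" for s h
  proof -
    define s' where "s' = t - (s + h)"
    have s': "s' \<ge> 0" "t - (s + h) = s'" "t - s = s' + h" using sh by (auto simp: s'_def)
    have "\<phi> (s + h) = (\<Sum>y'\<in>S. \<Sum>u\<in>U. \<Sum>y\<in>S. P s x y * P h y y' * R s' z u * D u y')"
      unfolding \<phi>_def s' by (intro sum.cong refl) (simp add: P_add s h x sum_distrib_right)
    also have "\<dots> = (\<Sum>y'\<in>S. \<Sum>y\<in>S. \<Sum>u\<in>U. P s x y * P h y y' * R s' z u * D u y')"
      by (intro sum.cong refl sum.swap)
    also have "\<dots> = (\<Sum>y\<in>S. \<Sum>y'\<in>S. \<Sum>u\<in>U. P s x y * P h y y' * R s' z u * D u y')"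
      by (rule sum.swap)
    also have "\<dots> = (\<Sum>y\<in>S. \<Sum>u\<in>U. \<Sum>y'\<in>S. P s x y * P h y y' * R s' z u * D u y')"
      by (intro sum.cong refl sum.swap)
    also have "\<dots> = (\<Sum>y\<in>S. \<Sum>u\<in>U. P s x y * R s' z u * (\<Sum>y'\<in>S. P h y y' * D u y'))"
      by (simp add: sum_distrib_left mult_ac)
    finally have 1: "\<phi> (s + h) = \<dots>" .
    have "\<phi> s = (\<Sum>y\<in>S. \<Sum>u'\<in>U. \<Sum>u\<in>U. P s x y * (R s' z u * R h u u') * D u' y)"
      unfolding \<phi>_def s'
      by (intro sum.cong refl) (simp add: R_add s'(1) h z sum_distrib_right sum_distrib_left)
    also have "\<dots> = (\<Sum>y\<in>S. \<Sum>u\<in>U. \<Sum>u'\<in>U. P s x y * (R s' z u * R h u u') * D u' y)"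
      by (intro sum.cong refl sum.swap)
    also have "\<dots> = (\<Sum>y\<in>S. \<Sum>u\<in>U. P s x y * R s' z u * (\<Sum>u'\<in>U. R h u u' * D u' y))"
      by (simp add: sum_distrib_left mult_ac)
    finally have 2: "\<phi> s = \<dots>" .
    have "\<phi> (s + h) - \<phi> s = (\<Sum>y\<in>S. \<Sum>u\<in>U. P s x y * R s' z u * e h y u)"
      unfolding 1 2 e_def by (simp add: sum_subtractf right_diff_distrib)
    also have "\<bar>\<dots>\<bar> \<le> (\<Sum>y\<in>S. \<Sum>u\<in>U. \<bar>P s x y * R s' z u * e h y u\<bar>)"
      by (intro order.trans[OF sum_abs] sum_mono order.refl)
    also have "\<dots> \<le> \<epsilon> h"
      unfolding \<epsilon>_def
    proof (intro sum_mono)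
      fix y u assume yu: "y \<in> S" "u \<in> U"
      have "P s x y \<le> 1"
        using member_le_sum[of y S "P s x"] P_nonneg[OF s x] P_sum[OF s x] S yu by auto
      moreover have "R s' z u \<le> 1"
        using member_le_sum[of u U "R s' z"] R_nonneg[OF s'(1) z] R_sum[OF s'(1) z] U yu by auto
      ultimately have "P s x y * R s' z u \<le> 1"
        using R_nonneg[OF s'(1) z yu(2)] P_nonneg[OF s x yu(1)] by (simp add: mult_le_one)
      moreover have "0 \<le> P s x y * R s' z u"
        using R_nonneg[OF s'(1) z yu(2)] P_nonneg[OF s x yu(1)] by simp
      ultimately show "\<bar>P s x y * R s' z u * e h y u\<bar> \<le> \<bar>e h y u\<bar>"
        by (simp only: abs_mult[of "P s x y * R s' z u"] abs_of_nonneg mult_left_le_one_le abs_ge_zero)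
    qed
    finally show ?thesis .
  qed

  have steps: "\<bar>\<phi> (real n * h) - \<phi> 0\<bar> \<le> real n * \<epsilon> h" if "h \<ge> 0" "real n * h \<le> t" for n h
    using that(2)
  proof (induction n)
    case 0
    then show ?case by simp
  next
    case (Suc n)
    have "real n * h + h \<le> t" using Suc.prems by (simp add: algebra_simps)
    moreover from this have "real n * h \<le> t" using that(1) by linarith
    ultimately show ?case
      using Suc.IH step[of "real n * h" h] that(1) by (simp add: algebra_simps)
  qed

  (* With n + 1 equal steps the total increment is at most t times \<epsilon> h / h at h = t / (n + 1). *)
  have "\<phi> t = \<phi> 0"
  proof (cases "t = 0")
    case False
    with t have t: "t > 0" by simp
    have "filterlim (\<lambda>n. t / real (Suc n)) (at_right 0) sequentially"
      unfolding filterlim_at using t LIMSEQ_Suc[OF lim_const_over_n[of t]] by auto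
    from filterlim_compose[OF \<epsilon>_lim this]
    have "(\<lambda>n. t * (\<epsilon> (t / real (Suc n)) / (t / real (Suc n)))) \<longlonglongrightarrow> t * 0"
      by (intro tendsto_mult tendsto_const)
    moreover have "\<bar>\<phi> t - \<phi> 0\<bar> \<le> t * (\<epsilon> (t / real (Suc n)) / (t / real (Suc n)))" for n
      using steps[of "t / real (Suc n)" "Suc n"] t by (simp add: mult.commute)
    ultimately have "\<bar>\<phi> t - \<phi> 0\<bar> \<le> t * 0"
      by (intro LIMSEQ_le_const) auto
    then show ?thesis by simp
  qed simp
  moreover have "\<phi> t = (\<Sum>y\<in>S. P t x y * D z y)"
    unfolding \<phi>_def
  proof (intro sum.cong refl)
    fix y
    have "(\<Sum>u\<in>U. P t x y * R (t - t) z u * D u y) = (\<Sum>u\<in>U. if u = z then P t x y * D z y else 0)"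
      using z by (intro sum.cong refl) (auto simp: R_0)
    then show "(\<Sum>u\<in>U. P t x y * R (t - t) z u * D u y) = P t x y * D z y"
      using z U by simp
  qed
  moreover have "\<phi> 0 = (\<Sum>u\<in>U. R t z u * D u x)"
  proof -
    have "\<phi> 0 = (\<Sum>u\<in>U. \<Sum>y\<in>S. P 0 x y * R (t - 0) z u * D u y)"
      unfolding \<phi>_def by (rule sum.swap)
    also have "\<dots> = (\<Sum>u\<in>U. \<Sum>y\<in>S. if y = x then R t z u * D u x else 0)"
      using x by (intro sum.cong refl) (auto simp: P_0)
    finally show ?thesis using x S by simp
  qed
  ultimately show ?thesis by simp
qed

text \<open>
  Only the Markov property at time 0, with empty past, enters here. The transition function is
  chosen once for all initial states and times.
\<close>

lemma cond_expect_markov_chain: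
  assumes "markov_chain S G M X"
  shows "\<exists>P. transition_function S G P \<and>
    (\<forall>x t f. x \<in> S \<longrightarrow> t \<ge> 0 \<longrightarrow> \<P>(w in M. X 0 w = x) > 0 \<longrightarrow>
       cond_expect M (\<lambda>w. f (X t w)) (\<lambda>w. X 0 w = x) = (\<Sum>y\<in>S. P t x y * f y))"
proof -
  from assms obtain P where P: "transition_function S G P"
    and markov: "\<forall>s\<ge>0. \<forall>h\<ge>0. \<forall>x\<in>S. \<forall>y\<in>S. \<forall>J xs. finite J \<longrightarrow> J \<subseteq> {0..s} \<longrightarrow>
          \<P>(w in M. X s w = x \<and> (\<forall>u\<in>J. X u w = xs u)) > 0 \<longrightarrow>
          \<P>(w in M. X (s + h) w = y \<bar> X s w = x \<and> (\<forall>u\<in>J. X u w = xs u)) = P h x y"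
    and S: "finite S" and prob: "prob_space M"
    and X: "\<And>t. t \<ge> 0 \<Longrightarrow> X t \<in> measurable M (count_space S)"
    unfolding markov_chain_def by auto
  interpret prob_space M by (rule prob)
  have "cond_expect M (\<lambda>w. f (X t w)) (\<lambda>w. X 0 w = x) = (\<Sum>y\<in>S. P t x y * f y)"
    if x: "x \<in> S" and t: "t \<ge> 0" and pos: "\<P>(w in M. X 0 w = x) > 0" for x t f
  proof -
    define A where "A y = {w \<in> space M. X t w = y \<and> X 0 w = x}" for y
    have A: "A y \<in> sets M" if "y \<in> S" for y
    proof -
      have "A y = (X t -` {y} \<inter> space M) \<inter> (X 0 -` {x} \<inter> space M)" by (auto simp: A_def)
      also have "\<dots> \<in> sets M"
        using x that by (intro sets.Int measurable_sets[OF X[OF t]] measurable_sets[OF X[of 0]]) auto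
      finally show ?thesis .
    qed
    have trans: "measure M (A y) = P t x y * \<P>(w in M. X 0 w = x)" if "y \<in> S" for y
      using markov[rule_format, of 0 t x y "{}" "\<lambda>_. x"] t x that pos
      by (simp add: cond_prob_def A_def field_simps)
    have "(LINT w:{w \<in> space M. X 0 w = x}|M. f (X t w))
        = (LINT w|M. (\<Sum>y\<in>S. f y * indicator (A y) w))"
      unfolding set_lebesgue_integral_def
    proof (rule Bochner_Integration.integral_cong[OF refl])
      fix w assume w: "w \<in> space M"
      then have "X t w \<in> S" using measurable_space[OF X[OF t]] by simp
      then have "(\<Sum>y\<in>S. f y * indicator (A y) w) = (\<Sum>y\<in>{X t w}. f y * indicator (A y) w)"
        by (intro sum.mono_neutral_right S) (auto simp: A_def)
      then show "indicat_real {w \<in> space M. X 0 w = x} w *\<^sub>R f (X t w)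
          = (\<Sum>y\<in>S. f y * indicator (A y) w)"
        using w by (simp add: A_def indicator_def)
    qed
    also have "\<dots> = (\<Sum>y\<in>S. f y * measure M (A y))"
      using A by (subst Bochner_Integration.integral_sum)
        (auto intro!: integrable_mult_right integrable_real_indicator simp: emeasure_eq_measure)
    also have "\<dots> = (\<Sum>y\<in>S. P t x y * f y) * \<P>(w in M. X 0 w = x)"
      by (simp add: trans sum_distrib_right mult_ac)
    finally show ?thesis using pos by (simp add: cond_expect_def)
  qed
  with P show ?thesis by blast
qed

theorem markov_chain_duality:
  assumes X: "markov_chain S G M X" and Z: "markov_chain U H N Z"
    and dual: "\<And>x z. x \<in> S \<Longrightarrow> z \<in> U \<Longrightarrow> G (D z) x = H (\<lambda>u. D u x) z"
    and "x \<in> S" and "z \<in> U" and "t \<ge> 0"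
    and "\<P>(w in M. X 0 w = x) > 0" and "\<P>(w in N. Z 0 w = z) > 0"
  shows "cond_expect M (\<lambda>w. D z (X t w)) (\<lambda>w. X 0 w = x) =
         cond_expect N (\<lambda>w. D (Z t w) x) (\<lambda>w. Z 0 w = z)"
proof -
  from X Z have fin: "finite S" "finite U" by (auto simp: markov_chain_def)
  obtain P where P: "transition_function S G P"
    and EX: "\<forall>x t f. x \<in> S \<longrightarrow> t \<ge> 0 \<longrightarrow> \<P>(w in M. X 0 w = x) > 0 \<longrightarrow>
       cond_expect M (\<lambda>w. f (X t w)) (\<lambda>w. X 0 w = x) = (\<Sum>y\<in>S. P t x y * f y)"
    using cond_expect_markov_chain[OF X] by blast
  obtain R where R: "transition_function U H R"
    and EZ: "\<forall>x t f. x \<in> U \<longrightarrow> t \<ge> 0 \<longrightarrow> \<P>(w in N. Z 0 w = x) > 0 \<longrightarrow>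
       cond_expect N (\<lambda>w. f (Z t w)) (\<lambda>w. Z 0 w = x) = (\<Sum>y\<in>U. R t x y * f y)"
    using cond_expect_markov_chain[OF Z] by blast
  have "(\<Sum>y\<in>S. P t x y * D z y) = (\<Sum>u\<in>U. R t z u * D u x)"
    by (rule transition_function_duality[OF P R fin dual]) (use assms in auto)
  then show ?thesis
    using EX[rule_format, of x t "D z"] EZ[rule_format, of z t "\<lambda>u. D u x"] assms(4-) by simp
qed


section \<open>Exchanging two neighbouring sites\<close>

definition jump_rate :: "real \<Rightarrow> real \<Rightarrow> nat \<Rightarrow> nat \<Rightarrow> real" where
  "jump_rate r l c c' = (if c < c' then r else if c' < c then l else 0)"

lemma swap_config_simps [simp]:
  "swap_config \<eta> k k = \<eta> (k + 1)" "swap_config \<eta> k (k + 1) = \<eta> k"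
  "j \<noteq> k \<Longrightarrow> j \<noteq> k + 1 \<Longrightarrow> swap_config \<eta> k j = \<eta> j"
  by (auto simp: swap_config_def)

lemma config_value:
  assumes "\<eta> \<in> configs L" "k \<in> sites L"
  shows "\<eta> k = 0 \<or> \<eta> k = 1 \<or> \<eta> k = 2"
  using PiE_mem[OF assms[unfolded configs_def]] by blast

lemma config_bond_values:
  assumes "\<eta> \<in> configs L" "k \<in> {-L + 1..L - 1}"
  shows "\<eta> k = 0 \<or> \<eta> k = 1 \<or> \<eta> k = 2" "\<eta> (k + 1) = 0 \<or> \<eta> (k + 1) = 1 \<or> \<eta> (k + 1) = 2"
  by (intro config_value[OF assms(1)]; use assms(2) in \<open>simp add: sites_def\<close>)+

lemma rate_eq_jump_rate:
  assumes "\<eta> \<in> configs L" "k \<in> {-L + 1..L - 1}"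
  shows "rate r l k \<eta> = jump_rate r l (\<eta> k) (\<eta> (k + 1))"
  using config_bond_values[OF assms]
  by (auto simp: rate_def jump_rate_def occ_a_def occ_v_def occ_b_def)

text \<open>
  An exchange permutes the summands when the index set contains both sites of the bond, and touches
  none of them when it contains neither.
\<close>

lemma sum_swap_config:
  assumes "k \<in> J \<longleftrightarrow> k + 1 \<in> J"
  shows "(\<Sum>m\<in>J. f (swap_config \<eta> k m)) = (\<Sum>m\<in>J. f (\<eta> m))"
proof -
  define \<tau> where "\<tau> m = (if m = k then k + 1 else if m = k + 1 then k else m)" for m
  have "\<tau> (\<tau> m) = m" "\<tau> m \<in> J \<longleftrightarrow> m \<in> J" "swap_config \<eta> k m = \<eta> (\<tau> m)" for m
    using assms by (auto simp: \<tau>_def swap_config_def)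
  then show ?thesis
    by (intro sum.reindex_bij_witness[of _ \<tau> \<tau>]) auto
qed

lemma sum_occ_swap_config:
  assumes "k \<in> J \<longleftrightarrow> k + 1 \<in> J"
  shows "sum (occ_a (swap_config \<eta> k)) J = sum (occ_a \<eta>) J"
    and "sum (occ_b (swap_config \<eta> k)) J = sum (occ_b \<eta>) J"
  using sum_swap_config[OF assms] by (simp_all add: occ_a_def occ_b_def)

lemma atLeastAtMost_bond:
  fixes k :: int
  assumes "a \<le> k" "k + 1 \<le> b"
  shows "{a..b} = insert k (insert (k + 1) ({a..b} - {k, k + 1}))"
  using assms by auto

section \<open>Reversibility\<close>

definition rev_measure_exponent :: "int \<Rightarrow> config \<Rightarrow> int" where
  "rev_measure_exponent L \<eta> = (\<Sum>k\<in>{-L + 1..L}. (2 * k - 1) * (occ_a \<eta> k - occ_b \<eta> k)) +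
             (\<Sum>k\<in>{-L + 1..L - 1}. \<Sum>m\<in>{-L + 1..k}.
                occ_a \<eta> m * occ_b \<eta> (k + 1) - occ_b \<eta> m * occ_a \<eta> (k + 1))"

text \<open>
  In the double sum, the interaction of the bond with any other site is only rearranged by the
  exchange. The interaction between the two sites of the bond is antisymmetric, so it changes sign
  and contributes minus twice its value.
\<close>

lemma rev_measure_exponent_swap:
  assumes k: "k \<in> {-L + 1..L - 1}"
  shows "rev_measure_exponent L (swap_config \<eta> k) = rev_measure_exponent L \<eta> +
    2 * ((occ_a \<eta> k - occ_b \<eta> k) - (occ_a \<eta> (k + 1) - occ_b \<eta> (k + 1))
         - (occ_a \<eta> k * occ_b \<eta> (k + 1) - occ_b \<eta> k * occ_a \<eta> (k + 1)))"
proof -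
  let ?\<eta>' = "swap_config \<eta> k"
  let ?I = "{-L + 1..L}"
  (* T \<zeta> n is the interaction of site n with the sites to its left. Indexing the double sum by the
     right-hand site n = k + 1 makes its range that of the single sum, because T vanishes at the
     leftmost site. *)
  define T where "T \<zeta> n = (\<Sum>m\<in>{-L + 1..n - 1}. occ_a \<zeta> m * occ_b \<zeta> n - occ_b \<zeta> m * occ_a \<zeta> n)"
    for \<zeta> n
  have exponent_alt: "rev_measure_exponent L \<zeta> = (\<Sum>n\<in>?I. (2 * n - 1) * (occ_a \<zeta> n - occ_b \<zeta> n) + T \<zeta> n)" for \<zeta>
  proof -
    have "(\<Sum>k\<in>{-L + 1..L - 1}. T \<zeta> (k + 1)) = (\<Sum>n\<in>{-L + 2..L}. T \<zeta> n)"
      by (rule sum.reindex_bij_witness[of _ "\<lambda>n. n - 1" "\<lambda>k. k + 1"]) auto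
    also have "\<dots> = (\<Sum>n\<in>?I. T \<zeta> n)"
      by (rule sum.mono_neutral_left) (auto simp: T_def)
    finally show ?thesis by (simp add: rev_measure_exponent_def T_def sum.distrib)
  qed
  have I: "?I = insert k (insert (k + 1) (?I - {k, k + 1}))"
    using k by (intro atLeastAtMost_bond) auto
  have occ: "occ_a ?\<eta>' k = occ_a \<eta> (k + 1)" "occ_a ?\<eta>' (k + 1) = occ_a \<eta> k"
    "occ_b ?\<eta>' k = occ_b \<eta> (k + 1)" "occ_b ?\<eta>' (k + 1) = occ_b \<eta> k"
    "\<And>j. j \<noteq> k \<Longrightarrow> j \<noteq> k + 1 \<Longrightarrow> occ_a ?\<eta>' j = occ_a \<eta> j"
    "\<And>j. j \<noteq> k \<Longrightarrow> j \<noteq> k + 1 \<Longrightarrow> occ_b ?\<eta>' j = occ_b \<eta> j"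
    by (auto simp: occ_a_def occ_b_def)
  have T_away: "T ?\<eta>' n = T \<eta> n" if "n \<noteq> k" "n \<noteq> k + 1" for n
  proof -
    have "k \<in> {-L + 1..n - 1} \<longleftrightarrow> k + 1 \<in> {-L + 1..n - 1}" using k that by auto
    from sum_occ_swap_config[OF this] show ?thesis
      by (simp add: T_def occ that sum_subtractf sum_distrib_right[symmetric])
  qed
  (* V c d is the interaction of the sites left of the bond with a site whose occupation numbers of
     types A and B are c and d. *)
  define V where "V c d = (\<Sum>m\<in>{-L + 1..k - 1}. occ_a \<eta> m * d - occ_b \<eta> m * c)" for c d
  have split: "{-L + 1..k + 1 - 1} = insert k {-L + 1..k - 1}" using k by auto
  have T_bond: "T \<eta> k = V (occ_a \<eta> k) (occ_b \<eta> k)"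
    "T \<eta> (k + 1) = V (occ_a \<eta> (k + 1)) (occ_b \<eta> (k + 1))
        + (occ_a \<eta> k * occ_b \<eta> (k + 1) - occ_b \<eta> k * occ_a \<eta> (k + 1))"
    "T ?\<eta>' k = V (occ_a \<eta> (k + 1)) (occ_b \<eta> (k + 1))"
    "T ?\<eta>' (k + 1) = V (occ_a \<eta> k) (occ_b \<eta> k)
        + (occ_a \<eta> (k + 1) * occ_b \<eta> k - occ_b \<eta> (k + 1) * occ_a \<eta> k)"
    unfolding T_def V_def split by (auto simp: occ intro!: sum.cong)
  have "(\<Sum>n\<in>?I - {k, k + 1}. (2 * n - 1) * (occ_a ?\<eta>' n - occ_b ?\<eta>' n) + T ?\<eta>' n) =
        (\<Sum>n\<in>?I - {k, k + 1}. (2 * n - 1) * (occ_a \<eta> n - occ_b \<eta> n) + T \<eta> n)"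
    by (intro sum.cong refl) (auto simp: occ T_away)
  then show ?thesis
    unfolding exponent_alt by (subst (1 2) I) (simp add: T_bond occ, simp add: algebra_simps)
qed

lemma rev_measure_pos: "0 < q \<Longrightarrow> 0 < rev_measure q L \<eta>"
  by (simp add: rev_measure_def zero_less_power_int)

text \<open>
  When increasing values at a bond are exchanged, the exponent increases by exactly 2, so \<open>\<pi>\<close>
  is multiplied by \<open>q\<^sup>2 = r / l\<close>. For the pair \<open>(A, B)\<close> the single sum alone would give 4; the
  interaction term corrects this.
\<close>

lemma detailed_balance:
  assumes "0 < q" and r: "r = q\<^sup>2 * l" and \<eta>: "\<eta> \<in> configs L" and k: "k \<in> {-L + 1..L - 1}"
  shows "rev_measure q L \<eta> * jump_rate r l (\<eta> k) (\<eta> (k + 1)) =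
         rev_measure q L (swap_config \<eta> k) * jump_rate r l (\<eta> (k + 1)) (\<eta> k)"
proof -
  have "rev_measure q L (swap_config \<eta> k) = rev_measure q L \<eta> *
    q powi (2 * ((occ_a \<eta> k - occ_b \<eta> k) - (occ_a \<eta> (k + 1) - occ_b \<eta> (k + 1))
         - (occ_a \<eta> k * occ_b \<eta> (k + 1) - occ_b \<eta> k * occ_a \<eta> (k + 1))))"
    unfolding rev_measure_def rev_measure_exponent_def[symmetric] rev_measure_exponent_swap[OF k]
    using \<open>0 < q\<close> by (intro power_int_add) auto
  then show ?thesis
    using config_bond_values[OF \<eta> k] \<open>0 < q\<close>
    by (auto simp: jump_rate_def occ_a_def occ_b_def r power_int_minus field_simps)
qed

section \<open>The duality relation for a single bond\<close>

definition site_factor :: "real \<Rightarrow> int \<Rightarrow> nat \<Rightarrow> int \<Rightarrow> config \<Rightarrow> real" where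
  "site_factor q L d x \<eta> = (if d = 0 then QA q L x \<eta> else if d = 2 then QB q L x \<eta> else 1)"

lemma Q_config_eq_prod: "Q_config q L z \<eta> = (\<Prod>x\<in>sites L. site_factor q L (z x) x \<eta>)"
proof -
  have "finite (sites L)" by (simp add: sites_def)
  then have "(\<Prod>x\<in>a_positions L z. QA q L x \<eta>) = (\<Prod>x\<in>sites L. if z x = 0 then QA q L x \<eta> else 1)"
    "(\<Prod>x\<in>b_positions L z. QB q L x \<eta>) = (\<Prod>x\<in>sites L. if z x = 2 then QB q L x \<eta> else 1)"
    by (auto simp: a_positions_def b_positions_def prod.inter_filter)
  then show ?thesis
    by (auto simp: Q_config_def prod.distrib[symmetric] site_factor_def intro!: prod.cong)
qed

text \<open>
  The product of the factors of \<open>Q\<close> at the two sites of a bond, for dual values \<open>d\<close>, \<open>d'\<close> and process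
  values \<open>c\<close>, \<open>c'\<close>. The powers of \<open>q\<close> contributed by the particles outside the bond are the same at
  both sites, and are collected in \<open>\<alpha>\<close> for type A and in \<open>\<beta>\<close> for type B; the remaining \<open>q\<close> and
  \<open>1 / q\<close> come from a particle of the same type at the other site of the bond.
\<close>

definition bond_weight :: "real \<Rightarrow> real \<Rightarrow> real \<Rightarrow> nat \<Rightarrow> nat \<Rightarrow> nat \<Rightarrow> nat \<Rightarrow> real" where
  "bond_weight q \<alpha> \<beta> d d' c c' =
     (if d = 0 then \<alpha> * (if c' = 0 then inverse q else 1) * of_bool (c = 0)
      else if d = 2 then \<beta> * (if c' = 2 then q else 1) * of_bool (c = 2) else 1) *
     (if d' = 0 then \<alpha> * (if c = 0 then q else 1) * of_bool (c' = 0)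
      else if d' = 2 then \<beta> * (if c = 2 then inverse q else 1) * of_bool (c' = 2) else 1)"

text \<open>
  The numbers \<open>\<alpha>\<close>, \<open>\<beta>\<close>, \<open>W\<close> are the same for all three products because they depend on \<open>z\<close> and
  \<open>\<eta>\<close> only through what an exchange at the bond preserves.
\<close>

lemma Q_config_bond:
  assumes "0 < q" and k: "k \<in> {-L + 1..L - 1}"
  obtains \<alpha> \<beta> W where
    "Q_config q L z \<eta> = W * bond_weight q \<alpha> \<beta> (z k) (z (k + 1)) (\<eta> k) (\<eta> (k + 1))"
    "Q_config q L (swap_config z k) \<eta> = W * bond_weight q \<alpha> \<beta> (z (k + 1)) (z k) (\<eta> k) (\<eta> (k + 1))"
    "Q_config q L z (swap_config \<eta> k) = W * bond_weight q \<alpha> \<beta> (z k) (z (k + 1)) (\<eta> (k + 1)) (\<eta> k)"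
proof -
  define A where "A = (\<Sum>j\<in>{-L + 1..k - 1}. occ_a \<eta> j) - (\<Sum>j\<in>{k + 2..L}. occ_a \<eta> j)"
  define B where "B = - (\<Sum>j\<in>{-L + 1..k - 1}. occ_b \<eta> j) + (\<Sum>j\<in>{k + 2..L}. occ_b \<eta> j)"
  define W where "W = (\<Prod>x\<in>sites L - {k, k + 1}. site_factor q L (z x) x \<eta>)"
  have sites: "sites L = insert k (insert (k + 1) (sites L - {k, k + 1}))"
    unfolding sites_def using k by (intro atLeastAtMost_bond) auto
  have fin: "finite (sites L)" by (simp add: sites_def)
  have split: "Q_config q L u \<zeta> = site_factor q L (u k) k \<zeta> * site_factor q L (u (k + 1)) (k + 1) \<zeta> * W"
    if u: "\<And>x. x \<noteq> k \<Longrightarrow> x \<noteq> k + 1 \<Longrightarrow> u x = z x"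
      and \<zeta>: "\<zeta> = \<eta> \<or> \<zeta> = swap_config \<eta> k" for u \<zeta>
  proof -
    have "site_factor q L (u x) x \<zeta> = site_factor q L (z x) x \<eta>" if x: "x \<in> sites L - {k, k + 1}" for x
    proof -
      have ivl: "k \<in> {-L + 1..x - 1} \<longleftrightarrow> k + 1 \<in> {-L + 1..x - 1}"
        "k \<in> {x + 1..L} \<longleftrightarrow> k + 1 \<in> {x + 1..L}" using k x by auto
      have "occ_a (swap_config \<eta> k) x = occ_a \<eta> x" "occ_b (swap_config \<eta> k) x = occ_b \<eta> x"
        using x by (auto simp: occ_a_def occ_b_def)
      then have "QA q L x \<zeta> = QA q L x \<eta>" "QB q L x \<zeta> = QB q L x \<eta>"
        using \<zeta> ivl[THEN sum_occ_swap_config(1)] ivl[THEN sum_occ_swap_config(2)]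
        by (auto simp: QA_def QB_def)
      then show ?thesis using u x by (simp add: site_factor_def)
    qed
    then have "(\<Prod>x\<in>sites L - {k, k + 1}. site_factor q L (u x) x \<zeta>) = W"
      unfolding W_def by (intro prod.cong refl) auto
    then show ?thesis
      unfolding Q_config_eq_prod by (subst sites) (simp add: fin mult_ac)
  qed
  have bond: "site_factor q L d k \<zeta> * site_factor q L d' (k + 1) \<zeta> =
      bond_weight q (q powi A) (q powi B) d d' (\<zeta> k) (\<zeta> (k + 1))"
    if \<zeta>: "\<zeta> = \<eta> \<or> \<zeta> = swap_config \<eta> k" for \<zeta> d d'
  proof -
    have A: "A = (\<Sum>j\<in>{-L + 1..k - 1}. occ_a \<zeta> j) - (\<Sum>j\<in>{k + 2..L}. occ_a \<zeta> j)"
      and B: "B = - (\<Sum>j\<in>{-L + 1..k - 1}. occ_b \<zeta> j) + (\<Sum>j\<in>{k + 2..L}. occ_b \<zeta> j)"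
      using \<zeta> by (auto simp: A_def B_def sum_occ_swap_config)
    have left: "{-L + 1..k + 1 - 1} = insert k {-L + 1..k - 1}"
      and right: "{k + 1..L} = insert (k + 1) {k + 2..L}" using k by auto
    have "QA q L k \<zeta> = q powi (A - occ_a \<zeta> (k + 1)) * of_int (occ_a \<zeta> k)"
      "QB q L k \<zeta> = q powi (B + occ_b \<zeta> (k + 1)) * of_int (occ_b \<zeta> k)"
      unfolding QA_def QB_def right A B by (auto simp: algebra_simps)
    moreover have "QA q L (k + 1) \<zeta> = q powi (A + occ_a \<zeta> k) * of_int (occ_a \<zeta> (k + 1))"
      "QB q L (k + 1) \<zeta> = q powi (B - occ_b \<zeta> k) * of_int (occ_b \<zeta> (k + 1))"
      unfolding QA_def QB_def left A B by (auto simp: algebra_simps)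
    ultimately show ?thesis
      using \<open>0 < q\<close>
      by (auto simp: site_factor_def bond_weight_def occ_a_def occ_b_def power_int_add power_int_diff
          divide_inverse)
  qed
  show ?thesis
    by (rule that[of W "q powi A" "q powi B"]) (simp_all add: split bond)
qed

text \<open>
  The core of the duality. The case of two A-particles at the bond shows how the powers of \<open>q\<close> work:
  for a dual A-particle at the left site and a dual vacancy at the right one, the process side
  vanishes, and on the dual side the gain and the loss are \<open>l \<alpha> q\<close> and \<open>r \<alpha> / q\<close>, which cancel
  because \<open>r = q\<^sup>2 l\<close>.
\<close>

lemma bond_weight_duality:
  assumes "0 < q" and "r = q\<^sup>2 * l"
    and "c \<in> {0, 1, 2}" "c' \<in> {0, 1, 2}" "d \<in> {0, 1, 2}" "d' \<in> {0, 1, 2}"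
  shows "jump_rate r l c c' * (bond_weight q \<alpha> \<beta> d d' c' c - bond_weight q \<alpha> \<beta> d d' c c') =
         jump_rate r l d' d * bond_weight q \<alpha> \<beta> d' d c c' - jump_rate r l d d' * bond_weight q \<alpha> \<beta> d d' c c'"
  using assms(3-6) unfolding assms(2)
proof (elim insertE emptyE, simp_all add: jump_rate_def bond_weight_def)
qed (use assms(1) in \<open>simp_all add: field_simps power2_eq_square\<close>)

text \<open>
  By detailed balance, \<open>rate(z) / \<pi>(z\<^sup>k)\<close> equals the rate of the reversed jump divided by
  \<open>\<pi>(z)\<close>, where \<open>z\<^sup>k\<close> denotes \<open>z\<close> after the exchange. The gain term then carries the same prefactor
  \<open>1 / \<pi>(z)\<close> as all the others, and the relation for \<open>D\<close> reduces to one for \<open>Q\<close>.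
\<close>

lemma duality_fun_bond:
  assumes q: "0 < q" "r = q\<^sup>2 * l" and z: "z \<in> configs L" and \<eta>: "\<eta> \<in> configs L"
    and k: "k \<in> {-L + 1..L - 1}"
  shows "rate r l k \<eta> * (duality_fun q L z (swap_config \<eta> k) - duality_fun q L z \<eta>) =
         rate r l k z * (duality_fun q L (swap_config z k) \<eta> - duality_fun q L z \<eta>)"
proof -
  obtain \<alpha> \<beta> W where Q:
    "Q_config q L z \<eta> = W * bond_weight q \<alpha> \<beta> (z k) (z (k + 1)) (\<eta> k) (\<eta> (k + 1))"
    "Q_config q L (swap_config z k) \<eta> = W * bond_weight q \<alpha> \<beta> (z (k + 1)) (z k) (\<eta> k) (\<eta> (k + 1))"
    "Q_config q L z (swap_config \<eta> k) = W * bond_weight q \<alpha> \<beta> (z k) (z (k + 1)) (\<eta> (k + 1)) (\<eta> k)"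
    by (rule Q_config_bond[OF q(1) k])
  let ?\<pi> = "rev_measure q L z" and ?\<pi>' = "rev_measure q L (swap_config z k)"
  let ?j = "jump_rate r l (z k) (z (k + 1))" and ?j' = "jump_rate r l (z (k + 1)) (z k)"
  have \<pi>: "?\<pi> > 0" "?\<pi>' > 0" by (simp_all add: rev_measure_pos q)
  have balance: "?j * inverse ?\<pi>' = ?j' * inverse ?\<pi>"
    using detailed_balance[OF q z k] \<pi> by (simp add: field_simps)
  have "rate r l k \<eta> * (Q_config q L z (swap_config \<eta> k) - Q_config q L z \<eta>) =
        ?j' * Q_config q L (swap_config z k) \<eta> - ?j * Q_config q L z \<eta>"
    using bond_weight_duality[OF q, of "\<eta> k" "\<eta> (k + 1)" "z k" "z (k + 1)" \<alpha> \<beta>, THEN arg_cong[where f = "(*) W"]]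
      config_bond_values[OF \<eta> k] config_bond_values[OF z k]
    by (simp add: Q rate_eq_jump_rate[OF \<eta> k] algebra_simps)
  from this[THEN arg_cong[where f = "(*) (inverse ?\<pi>)"]]
  have "rate r l k \<eta> * (duality_fun q L z (swap_config \<eta> k) - duality_fun q L z \<eta>) =
        (?j' * inverse ?\<pi>) * Q_config q L (swap_config z k) \<eta> - ?j * duality_fun q L z \<eta>"
    by (simp add: duality_fun_def algebra_simps)
  also have "\<dots> = ?j * (duality_fun q L (swap_config z k) \<eta> - duality_fun q L z \<eta>)"
    unfolding balance[symmetric] by (simp add: duality_fun_def algebra_simps)
  finally show ?thesis by (simp add: rate_eq_jump_rate[OF z k])
qed

section \<open>Self-duality of the two-component exclusion process\<close>

theorem theorem3p3:
  fixes L :: int and r l q t :: real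
    and M\<^sub>1 :: "'v measure" and \<eta>\<^sub>t :: "real \<Rightarrow> 'v \<Rightarrow> config"
    and M\<^sub>2 :: "'w measure" and z\<^sub>t :: "real \<Rightarrow> 'w \<Rightarrow> config"
    and \<eta> z :: config
  assumes "L \<ge> 1" and "0 < r" and "0 < l" and "q = sqrt (r / l)"
    and "asep2 r l L M\<^sub>1 \<eta>\<^sub>t" and "asep2 r l L M\<^sub>2 z\<^sub>t"
    and "z \<in> configs L" and "\<eta> \<in> configs L" and "t \<ge> 0"
    and "\<P>(w in M\<^sub>1. \<eta>\<^sub>t 0 w = \<eta>) > 0" and "\<P>(w in M\<^sub>2. z\<^sub>t 0 w = z) > 0"
  shows "cond_expect M\<^sub>1 (\<lambda>w. duality_fun q L z (\<eta>\<^sub>t t w)) (\<lambda>w. \<eta>\<^sub>t 0 w = \<eta>) =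
         cond_expect M\<^sub>2 (\<lambda>w. duality_fun q L (z\<^sub>t t w) \<eta>) (\<lambda>w. z\<^sub>t 0 w = z)"
proof (rule markov_chain_duality)
  have q: "0 < q" "r = q\<^sup>2 * l" using assms(2-4) by auto
  show "asep2_generator r l L (duality_fun q L u) \<zeta> =
        asep2_generator r l L (\<lambda>v. duality_fun q L v \<zeta>) u"
    if "\<zeta> \<in> configs L" "u \<in> configs L" for \<zeta> u
    unfolding asep2_generator_def by (intro sum.cong refl duality_fun_bond q that)
qed (use assms in \<open>auto simp: asep2_def\<close>)

end
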